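(* Let $n\ge1$ and let $H\in\mathbb{R}^{n\times n}$ be symmetric positive definite with smallest eigenvalue $a$. There exist constants $C_H\ge 1$ and $\rho_H\in(0,1)$, depending only on $H$, such that the following holds. Let $c\in\mathbb{R}^n$, $f(x)=\frac12x^THx-c^Tx$, $x_*=H^{-1}c$, let $W=\omega(H)$ be a fixed positive spectral weight (including $W=I$, BB1, and $W=H$, BB2), let $x_0\in\mathbb{R}^n$ be arbitrary, and let $\alpha_0\in(0,\infty)$ be an arbitrary first stepsize. Let $(x_k)_{k\ge0}$ be generated by the delayed weighted rule with zero continuation after termination, and let $g_k=H(x_k-x_* )$. Then for every $k\ge 1$, $$\lVert(g_k,g_{k+1})\rVert_\times\le C_H\sqrt{\kappa_2(W)}\,\rho_H^{\,k-1}\,\lVert(g_1,g_2)\rVert_\times,$$ and consequently $$\lVert x_k-x_*\rVert\le a^{-1}C_H\sqrt{\kappa_2(W)}\,\rho_H^{\,k-1}\,\lVert(g_1,g_2)\rVert_\times,$$ $$0\le f(x_k)-f(x_* )\le\frac{C_H^2\,\kappa_2(W)}{2a}\,\rho_H^{\,2(k-1)}\,\lVert(g_1,g_2)\rVert_\times^2.$$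
   Context: A positive spectral weight is a matrix $W=\omega(H)$ (functional calculus), where $\omega$ is a real function on the spectrum $\sigma(H)$ with $\omega(\lambda)>0$ for every $\lambda\in\sigma(H)$; thus $W$ is symmetric positive definite and commutes with $H$. Write $\kappa_2(W):=\lVert W\rVert_2\lVert W^{-1}\rVert_2$ (spectral norm). For $u\ne 0$ set $\alpha_W(u):=\dfrac{u^TWu}{u^TWHu}$. The delayed weighted rule is the gradient iteration $x_{k+1}=x_k-\alpha_kg_k$, where $g_k=\nabla f(x_k)=H(x_k-x_* )$, with $\alpha_0>0$ prescribed and $\alpha_k=\alpha_W(g_{k-1})$ for $k\ge 1$; equivalently $g_{k+1}=(I-\alpha_kH)g_k$. Zero continuation after termination means that if $g_j=0$ for some $j$, then $g_k=0$ and $x_k=x_*$ for all $k\ge j$. $\lVert\cdot\rVert$ is the Euclidean norm on $\mathbb{R}^n$ and $\lVert(u,v)\rVert_\times:=(\lVert u\rVert^2+\lVert v\rVert^2)^{1/2}$. *)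

theory Defs
  imports "HOL-Analysis.Analysis"
begin

definition spd :: "real^'n^'n \<Rightarrow> bool" where
  "spd A \<longleftrightarrow> transpose A = A \<and> (\<forall>v. v \<noteq> 0 \<longrightarrow> v \<bullet> (A *v v) > 0)"

definition eigenspace :: "real^'n^'n \<Rightarrow> real \<Rightarrow> (real^'n) set" where
  "eigenspace A l = {v. A *v v = l *\<^sub>R v}"

definition spectrum :: "real^'n^'n \<Rightarrow> real set" where
  "spectrum A = {l. \<exists>v. v \<noteq> 0 \<and> v \<in> eigenspace A l}"

definition min_eigenvalue :: "real^'n^'n \<Rightarrow> real" where
  "min_eigenvalue A = Min (spectrum A)"

(* For symmetric A this is the functional calculus given by the spectral decomposition
   of A: the map "closest_point (eigenspace A l)" is the orthogonal projection onto
   the eigenspace of l.  Only the values of w on the spectrum matter. *)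
definition matrix_fun :: "(real \<Rightarrow> real) \<Rightarrow> real^'n^'n \<Rightarrow> real^'n^'n" where
  "matrix_fun w A = (\<Sum>l\<in>spectrum A. w l *\<^sub>R matrix (closest_point (eigenspace A l)))"

definition positive_spectral_weight :: "real^'n^'n \<Rightarrow> real^'n^'n \<Rightarrow> bool" where
  "positive_spectral_weight H W \<longleftrightarrow>
     (\<exists>w. (\<forall>l\<in>spectrum H. w l > 0) \<and> W = matrix_fun w H)"

definition cond2 :: "real^'n^'n \<Rightarrow> real" where
  "cond2 W = onorm ((*v) W) * onorm ((*v) (matrix_inv W))"

definition quad_obj :: "real^'n^'n \<Rightarrow> real^'n \<Rightarrow> real^'n \<Rightarrow> real" where
  "quad_obj H c x = 1/2 * (x \<bullet> (H *v x)) - c \<bullet> x"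

definition quad_argmin :: "real^'n^'n \<Rightarrow> real^'n \<Rightarrow> real^'n" where
  "quad_argmin H c = matrix_inv H *v c"

(* For invertible symmetric H this is H x - c, the gradient of quad_obj H c at x. *)
definition quad_grad :: "real^'n^'n \<Rightarrow> real^'n \<Rightarrow> real^'n \<Rightarrow> real^'n" where
  "quad_grad H c x = H *v (x - quad_argmin H c)"

definition weighted_step :: "real^'n^'n \<Rightarrow> real^'n^'n \<Rightarrow> real^'n \<Rightarrow> real" where
  "weighted_step H W u = (u \<bullet> (W *v u)) / (u \<bullet> ((W ** H) *v u))"

(* The last conjunct is the zero continuation after termination.  The step sizes
   that would involve weighted_step at 0 are left unconstrained; they are not used,
   since the iteration has then already stopped.  The first step size is s 0. *)
definition delayed_weighted_rule ::
  "real^'n^'n \<Rightarrow> real^'n^'n \<Rightarrow> real^'n \<Rightarrow> (nat \<Rightarrow> real) \<Rightarrow> (nat \<Rightarrow> real^'n) \<Rightarrow> bool" where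
  "delayed_weighted_rule H W c s x \<longleftrightarrow>
     (\<forall>k\<ge>1. quad_grad H c (x (k - 1)) \<noteq> 0 \<longrightarrow>
        s k = weighted_step H W (quad_grad H c (x (k - 1)))) \<and>
     (\<forall>k. quad_grad H c (x k) \<noteq> 0 \<longrightarrow> x (k + 1) = x k - s k *\<^sub>R quad_grad H c (x k)) \<and>
     (\<forall>j. quad_grad H c (x j) = 0 \<longrightarrow>
        (\<forall>k\<ge>j. quad_grad H c (x k) = 0 \<and> x k = quad_argmin H c))"

end

theory Submission
  imports Defs
begin

text \<open>
  Why the theorem holds. In an orthonormal eigenbasis of \<open>H\<close> one step multiplies the component of
  the gradient at the eigenvalue \<open>l\<close> by \<open>1 - t l\<close>, where \<open>1 / t\<close> is the average of the eigenvalues with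
  respect to the energies \<open>w l * (norm (eigenproj H l u))\<^sup>2\<close> of the preceding gradient \<open>u\<close>. The energies of
  the iterates thus obey a recursion (\<open>delayed_energies\<close>) in which the weight no longer occurs: every
  positive spectral weight is BB1 in rescaled coordinates. A decay rate for this recursion depends
  only on the spectrum, and passing between energy and Euclidean norm costs the quotient of the largest
  and the smallest weight, which is at most \<open>cond2 W\<close> for squared norms
  (\<open>weight_ratio_le_cond2\<close>). This yields the factor \<open>sqrt (cond2 W)\<close>.

  The total energy need not decrease at each step, since a long step enlarges the components at
  large eigenvalues. But a long step is computed only from a gradient that is concentrated at small
  eigenvalues. If the components below \<open>l\<close> are small, a component at \<open>l\<close> that dominates them keeps
  the step short enough for its own contraction (\<open>dominant_component_contracts\<close>). Going through the
  eigenvalues in increasing order, all components become and remain a small fraction of the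
  initial energy after a number of steps that is uniform in the sequence
  (\<open>component_eventually_small\<close>). So the energy of two consecutive gradients is divided by at
  least four over each block of some fixed length, and geometric decay follows
  (\<open>delayed_energies_geometric_decay\<close>).

  The translation rests on the spectral theorem for symmetric matrices (\<open>spectral_resolution\<close>,
  \<open>spectral_decomposition\<close>), proved by minimising the Rayleigh quotient on invariant subspaces. The
  bounds for the error and for the objective gap follow from the one for the gradients, because the
  eigenvalues of \<open>H\<close> are at least \<open>min_eigenvalue H\<close>.
\<close>

section \<open>Spectral resolution of a symmetric matrix\<close>

abbreviation eigenproj :: "real^'n^'n \<Rightarrow> real \<Rightarrow> real^'n \<Rightarrow> real^'n" where
  "eigenproj A l \<equiv> closest_point (eigenspace A l)"

lemma symmetric_inner:
  fixes A :: "real^'n^'n"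
  assumes "transpose A = A"
  shows "(A *v x) \<bullet> y = x \<bullet> (A *v y)"
  by (metis assms dot_lmul_matrix vector_transpose_matrix)

lemma subspace_eigenspace: "subspace (eigenspace A l)"
  unfolding subspace_def eigenspace_def
  by (auto simp: matrix_vector_right_distrib scaleR_right_distrib matrix_vector_mult_scaleR)

text \<open>
  Comparing \<open>A u \<bullet> v = l (u \<bullet> v)\<close> with \<open>u \<bullet> A v = m (u \<bullet> v)\<close> forces \<open>u \<bullet> v = 0\<close>.
\<close>

lemma eigenspaces_orthogonal:
  assumes "transpose A = A" "l \<noteq> m" "u \<in> eigenspace A l" "v \<in> eigenspace A m"
  shows "u \<bullet> v = 0"
  using symmetric_inner[OF assms(1), of u v] assms by (simp add: eigenspace_def)

text \<open>
  Eigenvectors chosen one per eigenvalue are orthogonal, hence independent, so the dimension bounds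
  their number.
\<close>

lemma finite_spectrum:
  fixes A :: "real^'n^'n"
  assumes A: "transpose A = A"
  shows "finite (spectrum A)"
proof -
  have "\<forall>l\<in>spectrum A. \<exists>v. v \<noteq> 0 \<and> v \<in> eigenspace A l" by (auto simp: spectrum_def)
  from bchoice[OF this] obtain v where v: "\<And>l. l \<in> spectrum A \<Longrightarrow> v l \<noteq> 0 \<and> v l \<in> eigenspace A l"
    by blast
  have orth: "v l \<bullet> v m = 0" if "l \<in> spectrum A" "m \<in> spectrum A" "l \<noteq> m" for l m
    using eigenspaces_orthogonal[OF A that(3)] v that by blast
  then have "pairwise orthogonal (v ` spectrum A)"
    by (auto simp: pairwise_def orthogonal_def)
  then have "finite (v ` spectrum A)"
    using v by (intro independent_imp_finite pairwise_orthogonal_independent) auto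
  moreover have "inj_on v (spectrum A)"
    using orth v by (metis inj_onI inner_eq_zero_iff)
  ultimately show ?thesis using finite_imageD by blast
qed

text \<open>
  A minimiser \<open>v\<close> of the quadratic form on the unit sphere of \<open>S\<close> is an eigenvector: the
  Rayleigh quotient must be stationary at \<open>v\<close> in the direction of the residual \<open>w = A v - m v\<close>,
  which lies in \<open>S\<close> by invariance, and its derivative in that direction is \<open>2 (w \<bullet> w)\<close>.
\<close>

lemma invariant_subspace_has_eigenvector:
  fixes A :: "real^'n^'n"
  assumes A: "transpose A = A" and S: "subspace S" "S \<noteq> {0}" and inv: "\<And>v. v \<in> S \<Longrightarrow> A *v v \<in> S"
  shows "\<exists>l v. v \<in> S \<and> v \<noteq> 0 \<and> v \<in> eigenspace A l"
proof -
  let ?K = "S \<inter> sphere 0 1"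
  obtain s where "s \<in> S" "s \<noteq> 0" using S subspace_0 by blast
  then have "s /\<^sub>R norm s \<in> ?K" using S(1) by (auto simp: subspace_scale)
  moreover have "compact ?K" using S(1) by (simp add: closed_subspace closed_Int_compact)
  moreover have "continuous_on ?K (\<lambda>x. x \<bullet> (A *v x))"
    by (intro continuous_intros linear_continuous_on) (simp add: matrix_vector_mul_linear linear_linear)
  ultimately obtain v where v: "v \<in> ?K" and min: "\<And>x. x \<in> ?K \<Longrightarrow> v \<bullet> (A *v v) \<le> x \<bullet> (A *v x)"
    using continuous_attains_inf[of ?K "\<lambda>x. x \<bullet> (A *v x)"] by blast
  define m where "m = v \<bullet> (A *v v)"
  have ray: "m * (x \<bullet> x) \<le> x \<bullet> (A *v x)" if "x \<in> S" for x
  proof (cases "x = 0")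
    case False
    then have "x /\<^sub>R norm x \<in> ?K" using that S(1) by (auto simp: subspace_scale)
    from min[OF this] have "m \<le> (x \<bullet> (A *v x)) / (norm x)\<^sup>2"
      by (simp add: m_def matrix_vector_mult_scaleR power2_eq_square divide_inverse ac_simps)
    then show ?thesis using False by (simp add: field_simps power2_norm_eq_inner)
  qed simp
  define w where "w = A *v v - m *\<^sub>R v"
  have wS: "w \<in> S" unfolding w_def using v inv S(1) by (simp add: subspace_diff subspace_scale)
  have vv: "v \<bullet> v = 1" using v by (simp add: norm_eq_1)
  define q where "q = w \<bullet> (A *v w) - m * (w \<bullet> w)"
  have key: "0 \<le> 2 * t * (w \<bullet> w) + t\<^sup>2 * q" for t :: real
  proof -
    have "v + t *\<^sub>R w \<in> S" using v wS S(1) by (simp add: subspace_add subspace_scale)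
    from ray[OF this] have *: "m * ((v + t *\<^sub>R w) \<bullet> (v + t *\<^sub>R w)) \<le> (v + t *\<^sub>R w) \<bullet> (A *v (v + t *\<^sub>R w))" .
    have 1: "v \<bullet> (A *v w) = w \<bullet> (A *v v)" using symmetric_inner[OF A, of v w] by (simp add: inner_commute)
    have 2: "w \<bullet> (A *v v) = w \<bullet> w + m * (w \<bullet> v)" by (simp add: w_def inner_simps)
    show ?thesis using *
      by (simp add: inner_simps matrix_vector_right_distrib matrix_vector_mult_scaleR 1 2 vv
          m_def[symmetric] q_def power2_eq_square inner_commute[of v w] algebra_simps)
  qed
  have "w \<bullet> w = 0"
  proof (rule ccontr)
    assume "w \<bullet> w \<noteq> 0"
    then have p: "w \<bullet> w > 0" by (simp add: inner_gt_zero_iff)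
    \<comment> \<open>A negative \<open>t\<close> so small that the quadratic term cannot compensate the linear one.\<close>
    define t where "t = - (w \<bullet> w) / (\<bar>q\<bar> + 1)"
    have "0 \<le> t * (2 * (w \<bullet> w) + t * q)" using key[of t] by (simp add: algebra_simps power2_eq_square)
    moreover have "t < 0" using p by (simp add: t_def divide_neg_pos)
    ultimately have "2 * (w \<bullet> w) + t * q \<le> 0" by (simp add: zero_le_mult_iff)
    moreover have "\<bar>t * q\<bar> \<le> w \<bullet> w"
      using p by (simp add: t_def abs_mult divide_le_eq mult_left_mono)
    ultimately show False using p by linarith
  qed
  then have "v \<in> eigenspace A m" by (simp add: w_def eigenspace_def)
  moreover have "v \<noteq> 0" using vv by auto
  ultimately show ?thesis using v by blast
qed

text \<open>
  The vectors orthogonal to every eigenspace form an invariant subspace. Were it nonzero, it would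
  contain an eigenvector, which would be orthogonal to itself.
\<close>

lemma orthogonal_to_eigenspaces_imp_zero:
  fixes A :: "real^'n^'n"
  assumes A: "transpose A = A" and x: "\<And>l v. l \<in> spectrum A \<Longrightarrow> v \<in> eigenspace A l \<Longrightarrow> x \<bullet> v = 0"
  shows "x = 0"
proof (rule ccontr)
  assume "x \<noteq> 0"
  define S where "S = {y. \<forall>l. \<forall>v\<in>eigenspace A l. y \<bullet> v = 0}"
  have "x \<bullet> v = 0" if "v \<in> eigenspace A l" for l v
    using x[of l v] that by (cases "v = 0") (auto simp: spectrum_def)
  then have "x \<in> S" by (auto simp: S_def)
  have "subspace S" by (auto simp: S_def subspace_def inner_simps)
  moreover have "A *v y \<in> S" if "y \<in> S" for y
  proof -
    have "y \<bullet> (A *v v) = 0" if v: "v \<in> eigenspace A l" for l v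
      using \<open>y \<in> S\<close> v unfolding S_def eigenspace_def by fastforce
    then show ?thesis by (simp add: S_def symmetric_inner[OF A])
  qed
  ultimately obtain l v where "v \<in> S" "v \<noteq> 0" "v \<in> eigenspace A l"
    using invariant_subspace_has_eigenvector[OF A, of S] \<open>x \<in> S\<close> \<open>x \<noteq> 0\<close> by blast
  then have "v \<bullet> v = 0" unfolding S_def by blast
  then show False using \<open>v \<noteq> 0\<close> by simp
qed

lemma spectrum_nonempty:
  fixes A :: "real^'n^'n"
  assumes A: "transpose A = A"
  shows "spectrum A \<noteq> {}"
  using orthogonal_to_eigenspaces_imp_zero[OF A, of "axis undefined 1"]
  by (metis axis_eq_0_iff empty_iff zero_neq_one)

lemma eigenproj_in: "eigenproj A l x \<in> eigenspace A l"
  using subspace_eigenspace[of A l] subspace_0 by (blast intro: closest_point_in_set closed_subspace)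

lemma eigenproj_orthogonal:
  assumes "v \<in> eigenspace A l"
  shows "(x - eigenproj A l x) \<bullet> v = 0"
proof -
  let ?p = "eigenproj A l x"
  have E: "convex (eigenspace A l)" "closed (eigenspace A l)"
    by (simp_all add: subspace_imp_convex closed_subspace subspace_eigenspace)
  have "(x - ?p) \<bullet> (y - ?p) \<le> 0" if "y \<in> eigenspace A l" for y
    using closest_point_dot[OF E that] .
  \<comment> \<open>Both \<open>v\<close> and \<open>- v\<close> are admissible directions in a subspace, so the inequality is an equality.\<close>
  from this[of "?p + v"] this[of "?p - v"] show ?thesis
    using assms eigenproj_in[of A l x] subspace_eigenspace[of A l]
    by (simp add: subspace_add subspace_diff)
qed

lemma eigenproj_eqI:
  assumes "z \<in> eigenspace A l" and "\<And>v. v \<in> eigenspace A l \<Longrightarrow> (x - z) \<bullet> v = 0"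
  shows "eigenproj A l x = z"
proof -
  have d: "eigenproj A l x - z \<in> eigenspace A l"
    by (intro subspace_diff subspace_eigenspace eigenproj_in assms(1))
  from assms(2)[OF d] eigenproj_orthogonal[OF d, of x]
  have "(eigenproj A l x - z) \<bullet> (eigenproj A l x - z) = 0" by (simp add: inner_diff_left)
  then show ?thesis by simp
qed

lemma linear_eigenproj: "linear (eigenproj A l)"
proof (rule linearI)
  note sub = subspace_eigenspace[of A l]
  show "eigenproj A l (x + y) = eigenproj A l x + eigenproj A l y" for x y
    using eigenproj_orthogonal[of _ A l x] eigenproj_orthogonal[of _ A l y] sub
    by (intro eigenproj_eqI) (auto simp: eigenproj_in subspace_add inner_simps algebra_simps)
  show "eigenproj A l (c *\<^sub>R x) = c *\<^sub>R eigenproj A l x" for c x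
    using eigenproj_orthogonal[of _ A l x] sub
    by (intro eigenproj_eqI)
      (auto simp: eigenproj_in subspace_scale scaleR_diff_right[symmetric])
qed

lemma eigenproj_zero [simp]: "eigenproj A l 0 = 0"
  by (rule linear_0[OF linear_eigenproj])

lemma eigenproj_eigenvector:
  assumes A: "transpose A = A" and "v \<in> eigenspace A l"
  shows "eigenproj A m v = (if m = l then v else 0)"
  using assms eigenspaces_orthogonal[OF A, of l m v] subspace_eigenspace[of A m]
  by (intro eigenproj_eqI) (auto simp: subspace_0)

text \<open>
  A spectral function of \<open>A\<close> acts on the component at the eigenvalue \<open>m\<close> as multiplication by a
  number.
\<close>

lemma eigenproj_combination:
  assumes A: "transpose A = A" and m: "m \<in> spectrum A"
  shows "eigenproj A m (\<Sum>l\<in>spectrum A. c l *\<^sub>R eigenproj A l x) = c m *\<^sub>R eigenproj A m x"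
  using finite_spectrum[OF A] m
  by (simp add: linear_sum[OF linear_eigenproj] linear_cmul[OF linear_eigenproj]
      eigenproj_eigenvector[OF A eigenproj_in] if_distrib[of "scaleR _"] cong: if_cong)

lemma spectral_resolution:
  fixes A :: "real^'n^'n"
  assumes A: "transpose A = A"
  shows "(\<Sum>l\<in>spectrum A. eigenproj A l x) = x"
proof -
  have "x - (\<Sum>l\<in>spectrum A. eigenproj A l x) = 0"
  proof (rule orthogonal_to_eigenspaces_imp_zero[OF A])
    fix m v assume m: "m \<in> spectrum A" and v: "v \<in> eigenspace A m"
    have "(\<Sum>l\<in>spectrum A. eigenproj A l x) \<bullet> v = (\<Sum>l\<in>spectrum A. if l = m then eigenproj A m x \<bullet> v else 0)"
      unfolding inner_sum_left
      using eigenspaces_orthogonal[OF A _ eigenproj_in v] by (intro sum.cong) auto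
    then show "(x - (\<Sum>l\<in>spectrum A. eigenproj A l x)) \<bullet> v = 0"
      using eigenproj_orthogonal[OF v, of x] m finite_spectrum[OF A] by (simp add: inner_diff_left)
  qed
  then show ?thesis by simp
qed

lemma spectral_decomposition:
  fixes A :: "real^'n^'n"
  assumes A: "transpose A = A"
  shows "A *v x = (\<Sum>l\<in>spectrum A. l *\<^sub>R eigenproj A l x)"
proof -
  have "A *v x = (\<Sum>l\<in>spectrum A. A *v eigenproj A l x)"
    using arg_cong[OF spectral_resolution[OF A, of x], of "(*v) A"]
    by (simp add: linear_sum[OF matrix_vector_mul_linear])
  also have "\<dots> = (\<Sum>l\<in>spectrum A. l *\<^sub>R eigenproj A l x)"
    using eigenproj_in[of A _ x] by (simp add: eigenspace_def)
  finally show ?thesis .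
qed

lemma matrix_fun_apply:
  fixes A :: "real^'n^'n"
  shows "matrix_fun w A *v x = (\<Sum>l\<in>spectrum A. w l *\<^sub>R eigenproj A l x)"
proof -
  have [simp]: "(\<Sum>l\<in>S. f l) *v x = (\<Sum>l\<in>S. f l *v x)" for S and f :: "real \<Rightarrow> real^'n^'n"
    by (induction S rule: infinite_finite_induct) (simp_all add: matrix_vector_mult_add_rdistrib)
  show ?thesis
    unfolding matrix_fun_def
    by (simp add: scaleR_matrix_vector_assoc[symmetric] matrix_works linear_eigenproj)
qed

lemma inner_spectral:
  assumes A: "transpose A = A"
  shows "(\<Sum>l\<in>spectrum A. c l *\<^sub>R eigenproj A l x) \<bullet> (\<Sum>l\<in>spectrum A. d l *\<^sub>R eigenproj A l x)
           = (\<Sum>l\<in>spectrum A. c l * d l * (norm (eigenproj A l x))\<^sup>2)"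
proof -
  have "(\<Sum>m\<in>spectrum A. c l *\<^sub>R eigenproj A l x \<bullet> d m *\<^sub>R eigenproj A m x)
      = c l * d l * (norm (eigenproj A l x))\<^sup>2" if "l \<in> spectrum A" for l
  proof -
    have "(\<Sum>m\<in>spectrum A. c l *\<^sub>R eigenproj A l x \<bullet> d m *\<^sub>R eigenproj A m x)
        = (\<Sum>m\<in>spectrum A. if m = l then c l * d l * (norm (eigenproj A l x))\<^sup>2 else 0)"
      using eigenspaces_orthogonal[OF A _ eigenproj_in eigenproj_in, of l _ x x]
      by (intro sum.cong) (auto simp: power2_norm_eq_inner)
    then show ?thesis using that finite_spectrum[OF A] by simp
  qed
  then show ?thesis unfolding inner_sum_left unfolding inner_sum_right by (rule sum.cong[OF refl])
qed

lemma parseval: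
  assumes "transpose A = A"
  shows "(norm x)\<^sup>2 = (\<Sum>l\<in>spectrum A. (norm (eigenproj A l x))\<^sup>2)"
  using inner_spectral[OF assms, of "\<lambda>_. 1" x "\<lambda>_. 1"] spectral_resolution[OF assms, of x]
  by (simp add: power2_norm_eq_inner)

section \<open>Geometric decay of delayed energy sequences\<close>

text \<open>
  The delayed iteration seen by the spectrum alone. Intended reading: \<open>e k l\<close> is the weight at the
  eigenvalue \<open>l\<close> times the squared length of the spectral component of a gradient at \<open>l\<close>. The quotient
  of sums is then the stepsize computed from the gradient with index \<open>k\<close>, which acts on the next
  one. In this form the weight is no longer visible, and so bounds that depend only on \<open>S\<close> are
  uniform in the weight. The first case is the termination of the iteration.
\<close>

definition delayed_energies :: "real set \<Rightarrow> (nat \<Rightarrow> real \<Rightarrow> real) \<Rightarrow> bool" where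
  "delayed_energies S e \<longleftrightarrow>
     (\<forall>k. \<forall>l\<in>S. 0 \<le> e k l) \<and>
     (\<forall>k. if (\<Sum>l\<in>S. e k l) = 0 then \<forall>l\<in>S. e (Suc k) l = 0
          else \<forall>l\<in>S. e (Suc (Suc k)) l =
                 (1 - (\<Sum>m\<in>S. e k m) / (\<Sum>m\<in>S. m * e k m) * l)\<^sup>2 * e (Suc k) l)"

definition pair_energy :: "real set \<Rightarrow> (nat \<Rightarrow> real \<Rightarrow> real) \<Rightarrow> nat \<Rightarrow> real" where
  "pair_energy S e k = (\<Sum>l\<in>S. e k l) + (\<Sum>l\<in>S. e (Suc k) l)"

lemma delayed_energies_shift:
  "delayed_energies S e \<Longrightarrow> delayed_energies S (\<lambda>k. e (k + j))"
  unfolding delayed_energies_def by (metis add_Suc)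

lemma pair_energy_nonneg: "delayed_energies S e \<Longrightarrow> 0 \<le> pair_energy S e k"
  unfolding delayed_energies_def pair_energy_def by (simp add: sum_nonneg)

text \<open>
  The reciprocal of the stepsize is an average of eigenvalues.
\<close>

lemma stepsize_bounds:
  fixes f :: "real \<Rightarrow> real"
  assumes "finite S" and b: "\<And>l. l \<in> S \<Longrightarrow> a \<le> l \<and> l \<le> b" and "a > 0"
    and f: "\<And>l. l \<in> S \<Longrightarrow> 0 \<le> f l" and nz: "(\<Sum>l\<in>S. f l) \<noteq> 0"
  shows "0 < (\<Sum>l\<in>S. l * f l)"
    and "1 / b \<le> (\<Sum>l\<in>S. f l) / (\<Sum>l\<in>S. l * f l)"
    and "(\<Sum>l\<in>S. f l) / (\<Sum>l\<in>S. l * f l) \<le> 1 / a"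
proof -
  have F: "0 < (\<Sum>l\<in>S. f l)" using nz sum_nonneg[of S f] f by fastforce
  have lo: "a * (\<Sum>l\<in>S. f l) \<le> (\<Sum>l\<in>S. l * f l)"
    unfolding sum_distrib_left by (intro sum_mono mult_right_mono) (auto simp: b f)
  have hi: "(\<Sum>l\<in>S. l * f l) \<le> b * (\<Sum>l\<in>S. f l)"
    unfolding sum_distrib_left by (intro sum_mono mult_right_mono) (auto simp: b f)
  show pos: "0 < (\<Sum>l\<in>S. l * f l)"
    using lo F \<open>a > 0\<close> by (smt (verit) mult_pos_pos)
  have "0 < b" using hi pos F by (smt (verit) mult_nonpos_nonneg)
  show "1 / b \<le> (\<Sum>l\<in>S. f l) / (\<Sum>l\<in>S. l * f l)"
    using hi pos \<open>0 < b\<close> by (simp add: field_simps)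
  show "(\<Sum>l\<in>S. f l) / (\<Sum>l\<in>S. l * f l) \<le> 1 / a"
    using lo pos \<open>0 < a\<close> by (simp add: field_simps)
qed

text \<open>
  The step has length at most \<open>1 / a\<close>, so a component is multiplied by \<open>1 - t l\<close> with
  \<open>0 \<le> t l \<le> b / a\<close>.
\<close>

lemma energy_growth:
  assumes e: "delayed_energies S e" and S: "finite S" and ab: "\<And>l. l \<in> S \<Longrightarrow> a \<le> l \<and> l \<le> b"
    and "a > 0" and l: "l \<in> S"
  shows "e (Suc (Suc k)) l \<le> (1 + (b / a)\<^sup>2) * e (Suc k) l"
proof -
  have nn: "\<And>k l. l \<in> S \<Longrightarrow> 0 \<le> e k l" using e by (auto simp: delayed_energies_def)
  show ?thesis
  proof (cases "(\<Sum>l\<in>S. e k l) = 0")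
    case True
    then have 0: "\<forall>l\<in>S. e (Suc k) l = 0" using e by (auto simp: delayed_energies_def)
    then have "(\<Sum>l\<in>S. e (Suc k) l) = 0" by simp
    then have "\<forall>l\<in>S. e (Suc (Suc k)) l = 0" using e unfolding delayed_energies_def by meson
    then show ?thesis using 0 l by simp
  next
    case False
    define t where "t = (\<Sum>l\<in>S. e k l) / (\<Sum>l\<in>S. l * e k l)"
    have eq: "e (Suc (Suc k)) l = (1 - t * l)\<^sup>2 * e (Suc k) l"
      using e False l unfolding delayed_energies_def t_def by meson
    have "1 / b \<le> t" "t \<le> 1 / a"
      unfolding t_def using stepsize_bounds[OF S ab \<open>a > 0\<close> nn False] by auto
    moreover have "0 < l" "l \<le> b" using ab[OF l] \<open>a > 0\<close> by auto
    ultimately have t: "0 \<le> t * l" "t * l \<le> 1 / a * b"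
      using \<open>a > 0\<close> by (smt (verit) divide_pos_pos mult_pos_pos, intro mult_mono, auto)
    then have "(t * l)\<^sup>2 \<le> (b / a)\<^sup>2" by (intro power_mono) auto
    then have "(1 - t * l)\<^sup>2 \<le> 1 + (b / a)\<^sup>2"
      using t by (simp add: power2_eq_square algebra_simps)
    then show ?thesis unfolding eq by (intro mult_right_mono nn l)
  qed
qed

text \<open>
  A large value forces a contraction only one step later, because of the delay. So a sequence that has
  fallen below the threshold \<open>T\<close> may still grow freely twice before it must decrease again; this is
  the origin of the factor \<open>G\<^sup>2\<close>, and it makes the bound persist for all later indices.
\<close>

lemma delayed_contraction:
  fixes u :: "nat \<Rightarrow> real"
  assumes "G \<ge> 1" "0 \<le> r" "r \<le> 1" "0 \<le> T"
    and grow: "\<And>k. u (Suc k) \<le> G * u k"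
    and contr: "\<And>k. u k > T \<Longrightarrow> u (Suc (Suc k)) \<le> r * u (Suc k)"
  shows "u (Suc j) \<le> max (G\<^sup>2 * T) (r ^ j * u 1)"
proof (induction j)
  case (Suc j)
  show ?case
  proof (cases "u j > T")
    case True
    have "r * u (Suc j) \<le> max (r * (G\<^sup>2 * T)) (r * (r ^ j * u 1))"
      using mult_left_mono[OF Suc \<open>0 \<le> r\<close>] \<open>0 \<le> r\<close> by (simp add: max_mult_distrib_left)
    moreover have "r * (G\<^sup>2 * T) \<le> G\<^sup>2 * T"
      using assms by (intro mult_left_le_one_le) auto
    ultimately show ?thesis using contr[OF True] by (auto simp: le_max_iff_disj mult.assoc)
  next
    case False
    have "u (Suc (Suc j)) \<le> G * (G * u j)"
      using grow[of "Suc j"] mult_left_mono[OF grow[of j], of G] \<open>G \<ge> 1\<close> by linarith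
    also have "\<dots> \<le> G * (G * T)" using False \<open>G \<ge> 1\<close> by (intro mult_left_mono) auto
    finally show ?thesis by (simp add: power2_eq_square mult.assoc)
  qed
qed simp

text \<open>
  If the energy at \<open>l\<close> exceeds twice the energy below \<open>l\<close>, then at least two thirds of the total
  energy sit at eigenvalues \<open>\<ge> l\<close>. The average of eigenvalues is therefore at least \<open>2 l / 3\<close>, the
  stepsize \<open>t\<close> satisfies \<open>a / b \<le> t l \<le> 3 / 2\<close>, and \<open>\<bar>1 - t l\<bar>\<close> is bounded away from \<open>1\<close>.
\<close>

lemma dominant_component_contracts:
  assumes e: "delayed_energies S e" and S: "finite S" and ab: "\<And>l. l \<in> S \<Longrightarrow> a \<le> l \<and> l \<le> b"
    and "a > 0" and l: "l \<in> S"
    and dom: "2 * (\<Sum>m\<in>{m\<in>S. m < l}. e k m) < e k l"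
  shows "e (Suc (Suc k)) l \<le> max (1/4) ((1 - a / b)\<^sup>2) * e (Suc k) l"
proof -
  have nn: "\<And>k l. l \<in> S \<Longrightarrow> 0 \<le> e k l" using e by (auto simp: delayed_energies_def)
  let ?lo = "\<Sum>m\<in>{m\<in>S. m < l}. e k m" and ?hi = "\<Sum>m\<in>{m\<in>S. l \<le> m}. e k m"
  have split: "(\<Sum>m\<in>S. h m) = (\<Sum>m\<in>{m\<in>S. m < l}. h m) + (\<Sum>m\<in>{m\<in>S. l \<le> m}. h m)"
    for h :: "real \<Rightarrow> real"
    by (subst sum.union_disjoint[symmetric]) (auto simp: S intro!: sum.cong)
  have lo: "0 \<le> ?lo" by (intro sum_nonneg) (auto simp: nn)
  have hi: "e k l \<le> ?hi" by (rule member_le_sum) (auto simp: S l nn)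
  have nz: "(\<Sum>m\<in>S. e k m) \<noteq> 0" using split[of "e k"] lo hi dom by linarith
  have "0 < l" "a \<le> l" "l \<le> b" using ab[OF l] \<open>a > 0\<close> by auto
  define t where "t = (\<Sum>m\<in>S. e k m) / (\<Sum>m\<in>S. m * e k m)"
  have eq: "e (Suc (Suc k)) l = (1 - t * l)\<^sup>2 * e (Suc k) l"
    using e nz l unfolding delayed_energies_def t_def by meson
  note sb = stepsize_bounds[OF S ab \<open>a > 0\<close> nn nz]
  have "l * ?hi \<le> (\<Sum>m\<in>{m\<in>S. l \<le> m}. m * e k m)"
    unfolding sum_distrib_left by (intro sum_mono mult_right_mono) (auto simp: nn)
  moreover have "0 \<le> (\<Sum>m\<in>{m\<in>S. m < l}. m * e k m)"
    using ab \<open>a > 0\<close> by (intro sum_nonneg mult_nonneg_nonneg) (force simp: nn)+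
  ultimately have "l * ?hi \<le> (\<Sum>m\<in>S. m * e k m)" using split[of "\<lambda>m. m * e k m"] by linarith
  moreover have "2 * (\<Sum>m\<in>S. e k m) \<le> 3 * ?hi" using split[of "e k"] hi dom by linarith
  then have "l * (2 * (\<Sum>m\<in>S. e k m)) \<le> l * (3 * ?hi)" using \<open>0 < l\<close> by (intro mult_left_mono) auto
  ultimately have "t * l \<le> 3 / 2" unfolding t_def using sb(1) by (simp add: field_simps)
  moreover have "a / b \<le> t * l"
  proof -
    have "1 / b * a \<le> t * l"
      using sb(2) \<open>a > 0\<close> \<open>a \<le> l\<close> \<open>l \<le> b\<close> unfolding t_def[symmetric]
      by (intro mult_mono) (auto intro: order_trans[rotated])
    then show ?thesis by simp
  qed
  moreover have "a / b \<le> 1" using \<open>a \<le> l\<close> \<open>l \<le> b\<close> \<open>a > 0\<close> by simp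
  ultimately have "\<bar>1 - t * l\<bar> \<le> 1 / 2 \<or> \<bar>1 - t * l\<bar> \<le> \<bar>1 - a / b\<bar>" by linarith
  then have "(1 - t * l)\<^sup>2 \<le> max (1/4) ((1 - a / b)\<^sup>2)"
    using abs_le_square_iff[of "1 - t * l" "1/2"] abs_le_square_iff[of "1 - t * l" "1 - a/b"]
    by (auto simp: power2_eq_square le_max_iff_disj)
  then show ?thesis unfolding eq by (intro mult_right_mono nn l)
qed

lemma energy_growth_power:
  assumes e: "delayed_energies S e" and S: "finite S" and ab: "\<And>l. l \<in> S \<Longrightarrow> a \<le> l \<and> l \<le> b"
    and "a > 0" and l: "l \<in> S"
  shows "e (Suc k) l \<le> (1 + (b / a)\<^sup>2) ^ k * e 1 l"
proof (induction k)
  case (Suc k)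
  have "e (Suc (Suc k)) l \<le> (1 + (b / a)\<^sup>2) * ((1 + (b / a)\<^sup>2) ^ k * e 1 l)"
    using order_trans[OF energy_growth[OF e S ab \<open>a > 0\<close> l] mult_left_mono[OF Suc]] by simp
  then show ?case by (simp add: mult.assoc)
qed simp

text \<open>
  Strong induction along the eigenvalues in increasing order. Once the components below \<open>l\<close> are
  permanently tiny compared with the initial energy, the component at \<open>l\<close> contracts as long as it
  dominates them, and afterwards it can exceed them only by a bounded factor. The point is the order of
  the quantifiers: \<open>N\<close> does not depend on the sequence.
\<close>

lemma component_eventually_small:
  assumes S: "finite S" and ab: "\<And>l. l \<in> S \<Longrightarrow> a \<le> l \<and> l \<le> b" and "a > 0"
    and "l \<in> S" and "\<delta> > 0"
  shows "\<exists>N. \<forall>e. delayed_energies S e \<longrightarrow> (\<forall>k\<ge>N. e k l \<le> \<delta> * pair_energy S e 0)"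
  using \<open>l \<in> S\<close> \<open>\<delta> > 0\<close>
proof (induction "card {m\<in>S. m < l}" arbitrary: l \<delta> rule: less_induct)
  case (less l \<delta>)
  define G where "G = 1 + (b / a)\<^sup>2"
  define r where "r = max (1/4) ((1 - a / b)\<^sup>2)"
  have G: "G \<ge> 1" by (simp add: G_def)
  have "0 < a / b" "a / b \<le> 1" using ab[OF \<open>l \<in> S\<close>] \<open>a > 0\<close> by auto
  then have "(1 - a / b)\<^sup>2 < 1" by (simp add: abs_square_less_1)
  then have r: "0 \<le> r" "r < 1" by (auto simp: r_def)
  define n where "n = real (card S)"
  have n: "n > 0" unfolding n_def using S \<open>l \<in> S\<close> by (auto simp: card_gt_0_iff)
  \<comment> \<open>At most \<open>n\<close> smaller eigenvalues, a factor 2 for dominance, and \<open>G\<^sup>2\<close> for the delay.\<close>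
  define \<epsilon> where "\<epsilon> = \<delta> / (2 * n * G\<^sup>2)"
  have "\<epsilon> > 0" unfolding \<epsilon>_def using n G \<open>\<delta> > 0\<close> by simp
  have "\<forall>m\<in>{m\<in>S. m < l}. \<exists>N. \<forall>e. delayed_energies S e \<longrightarrow> (\<forall>k\<ge>N. e k m \<le> \<epsilon> * pair_energy S e 0)"
  proof
    fix m assume m: "m \<in> {m\<in>S. m < l}"
    then have "card {j\<in>S. j < m} < card {m\<in>S. m < l}"
      using S by (intro psubset_card_mono) auto
    then show "\<exists>N. \<forall>e. delayed_energies S e \<longrightarrow> (\<forall>k\<ge>N. e k m \<le> \<epsilon> * pair_energy S e 0)"
      using less.hyps[of m \<epsilon>] m \<open>\<epsilon> > 0\<close> by auto
  qed
  from bchoice[OF this] obtain N' where N': "\<And>m e k. m \<in> S \<Longrightarrow> m < l \<Longrightarrow> delayed_energies S e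
      \<Longrightarrow> N' m \<le> k \<Longrightarrow> e k m \<le> \<epsilon> * pair_energy S e 0"
    by blast
  \<comment> \<open>The successor matters: \<open>e 0\<close> and \<open>e 1\<close> are independent data, so growth is controlled from index 1 on.\<close>
  define N where "N = Suc (Max (insert 0 (N' ` S)))"
  have NN: "N' m \<le> N" if "m \<in> S" for m
    unfolding N_def using S that by (intro le_SucI Max_ge) auto
  obtain J where J: "r ^ J < \<delta> / G ^ N"
    using real_arch_pow_inv[of "\<delta> / G ^ N" r] r \<open>\<delta> > 0\<close> G by auto
  have "\<forall>k\<ge>N + Suc J. e k l \<le> \<delta> * pair_energy S e 0" if e: "delayed_energies S e" for e
  proof (intro allI impI)
    fix k assume "k \<ge> N + Suc J"
    then obtain i where k: "k = N + Suc (J + i)" by (metis add_Suc_right add_Suc_shift le_Suc_ex add.assoc)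
    define E where "E = pair_energy S e 0"
    define u where "u j = e (j + N) l" for j
    have nn: "\<And>k l. l \<in> S \<Longrightarrow> 0 \<le> e k l" using e by (auto simp: delayed_energies_def)
    have E: "0 \<le> E" "e 1 l \<le> E"
      using pair_energy_nonneg[OF e] member_le_sum[of l S "e 1"] sum_nonneg[of S "e 0"] nn S \<open>l \<in> S\<close>
      by (auto simp: E_def pair_energy_def)
    note gr = energy_growth[OF e S ab \<open>a > 0\<close> \<open>l \<in> S\<close>, folded G_def]
    have "u (Suc (J + i)) \<le> max (G\<^sup>2 * (2 * (n * (\<epsilon> * E)))) (r ^ (J + i) * u 1)"
    proof (rule delayed_contraction[OF G])
      show "0 \<le> r" "r \<le> 1" using r by auto
      show "0 \<le> 2 * (n * (\<epsilon> * E))" using n \<open>\<epsilon> > 0\<close> E by simp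
      show "u (Suc j) \<le> G * u j" for j
        unfolding u_def N_def using gr[of "j + Max (insert 0 (N' ` S))"] by simp
      fix j assume big: "u j > 2 * (n * (\<epsilon> * E))"
      have "(\<Sum>m\<in>{m\<in>S. m < l}. e (j + N) m) \<le> (\<Sum>m\<in>{m\<in>S. m < l}. \<epsilon> * E)"
        using N' e NN unfolding E_def by (intro sum_mono) (simp add: trans_le_add2)
      also have "\<dots> \<le> n * (\<epsilon> * E)"
        unfolding n_def using S \<open>\<epsilon> > 0\<close> E by (auto intro!: mult_right_mono card_mono)
      finally show "u (Suc (Suc j)) \<le> r * u (Suc j)"
        using dominant_component_contracts[OF e S ab \<open>a > 0\<close> \<open>l \<in> S\<close>, of "j + N"] big
        by (simp add: u_def r_def)
    qed
    moreover have "G\<^sup>2 * (2 * (n * (\<epsilon> * E))) = \<delta> * E" unfolding \<epsilon>_def using n G by simp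
    moreover have "r ^ (J + i) * u 1 \<le> \<delta> * E"
    proof -
      have "u 1 \<le> G ^ N * e 1 l"
        using energy_growth_power[OF e S ab \<open>a > 0\<close> \<open>l \<in> S\<close>, of N] by (simp add: u_def G_def)
      also have "\<dots> \<le> G ^ N * E" using E G by (intro mult_left_mono) auto
      finally have "u 1 \<le> G ^ N * E" .
      moreover have "r ^ (J + i) \<le> \<delta> / G ^ N"
        using J power_decreasing[of J "J + i" r] r by linarith
      ultimately have "r ^ (J + i) * u 1 \<le> \<delta> / G ^ N * (G ^ N * E)"
        using \<open>\<delta> > 0\<close> G nn[OF \<open>l \<in> S\<close>] by (intro mult_mono) (auto simp: u_def)
      then show ?thesis using G by simp
    qed
    ultimately have "u (Suc (J + i)) \<le> \<delta> * E" by simp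
    then show "e k l \<le> \<delta> * pair_energy S e 0" by (simp add: u_def k E_def add.commute)
  qed
  then show ?case by blast
qed

lemma geometric_decay_of_block_contraction:
  fixes E :: "nat \<Rightarrow> real"
  assumes "N > 0" "B \<ge> 1" "0 < \<theta>" "\<theta> \<le> 1"
    and grow: "\<And>k. E (Suc k) \<le> B * E k" and block: "\<And>k. E (k + N) \<le> \<theta> ^ N * E k"
    and nn: "\<And>k. 0 \<le> E k"
  shows "E k \<le> (B / \<theta>) ^ N * \<theta> ^ k * E 0"
proof (induction k rule: less_induct)
  case (less k)
  show ?case
  proof (cases "k < N")
    case True
    have "E k \<le> B ^ k * E 0"
    proof (induction k)
      case (Suc k)
      then show ?case using order_trans[OF grow[of k] mult_left_mono[OF Suc, of B]] \<open>B \<ge> 1\<close>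
        by (simp add: mult.assoc)
    qed simp
    moreover have "B ^ k \<le> B ^ N" using True \<open>B \<ge> 1\<close> by (intro power_increasing) auto
    moreover have "\<theta> ^ N \<le> \<theta> ^ k" using True assms by (intro power_decreasing) auto
    then have "B ^ N \<le> (B / \<theta>) ^ N * \<theta> ^ k"
      using \<open>0 < \<theta>\<close> \<open>B \<ge> 1\<close> by (simp add: power_divide field_simps)
    ultimately show ?thesis by (meson mult_right_mono nn order_trans)
  next
    case False
    then obtain j where k: "k = j + N" by (metis add.commute le_Suc_ex not_less)
    then have "E k \<le> \<theta> ^ N * E j" using block by simp
    also have "\<dots> \<le> \<theta> ^ N * ((B / \<theta>) ^ N * \<theta> ^ j * E 0)"
      using less[of j] k \<open>N > 0\<close> \<open>0 < \<theta>\<close> by (intro mult_left_mono) auto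
    finally show ?thesis by (simp add: k power_add ac_simps)
  qed
qed

text \<open>
  After a block of \<open>N\<close> steps every component is at most \<open>1 / (8 n)\<close> of the initial pair energy, so
  the pair energy has dropped by the factor \<open>1 / 4\<close>. The recursion is invariant under shifts in
  time, hence the same block length works from every starting index.
\<close>

theorem delayed_energies_geometric_decay:
  assumes S: "finite S" "S \<noteq> {}" and pos: "\<And>l. l \<in> S \<Longrightarrow> 0 < l"
  shows "\<exists>C \<rho>. C \<ge> 1 \<and> 0 < \<rho> \<and> \<rho> < 1 \<and>
    (\<forall>e k. delayed_energies S e \<longrightarrow> pair_energy S e k \<le> (C * \<rho> ^ k)\<^sup>2 * pair_energy S e 0)"
proof -
  define a where "a = Min S"
  define b where "b = Max S"
  have ab: "\<And>l. l \<in> S \<Longrightarrow> a \<le> l \<and> l \<le> b" and "a > 0"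
    using S pos by (auto simp: a_def b_def)
  define n where "n = real (card S)"
  have n: "n > 0" unfolding n_def using S by (auto simp: card_gt_0_iff)
  have "\<forall>l\<in>S. \<exists>N. \<forall>e. delayed_energies S e \<longrightarrow> (\<forall>k\<ge>N. e k l \<le> 1 / (8 * n) * pair_energy S e 0)"
    using component_eventually_small[OF S(1) ab \<open>a > 0\<close>] n by (metis zero_less_divide_1_iff zero_less_mult_iff zero_less_numeral)
  from bchoice[OF this] obtain N' where N': "\<And>l e k. l \<in> S \<Longrightarrow> delayed_energies S e
      \<Longrightarrow> N' l \<le> k \<Longrightarrow> e k l \<le> 1 / (8 * n) * pair_energy S e 0"
    by blast
  define N where "N = Suc (Max (insert 0 (N' ` S)))"
  have NN: "N' m \<le> N" if "m \<in> S" for m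
    unfolding N_def using S that by (intro le_SucI Max_ge) auto
  have N: "N > 0" by (simp add: N_def)
  have small: "(\<Sum>l\<in>S. e k l) \<le> 1/8 * pair_energy S e 0" if "delayed_energies S e" "k \<ge> N" for e k
  proof -
    have "(\<Sum>l\<in>S. e k l) \<le> (\<Sum>l\<in>S. 1 / (8 * n) * pair_energy S e 0)"
      using N' NN that by (intro sum_mono) (meson order_trans)
    then show ?thesis using n by (simp add: n_def)
  qed
  have quarter: "pair_energy S e (k + N) \<le> 1/4 * pair_energy S e k" if e: "delayed_energies S e" for e k
    using small[OF delayed_energies_shift[OF e, of k], of N] small[OF delayed_energies_shift[OF e, of k], of "Suc N"]
    by (simp add: pair_energy_def add.commute)
  define B where "B = 2 + (b / a)\<^sup>2"
  have B: "B \<ge> 1" by (simp add: B_def)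
  have grow: "pair_energy S e (Suc k) \<le> B * pair_energy S e k" if e: "delayed_energies S e" for e k
  proof -
    have "(\<Sum>l\<in>S. e (Suc (Suc k)) l) \<le> (1 + (b / a)\<^sup>2) * (\<Sum>l\<in>S. e (Suc k) l)"
      unfolding sum_distrib_left
      by (intro sum_mono energy_growth[OF e S(1) ab \<open>a > 0\<close>])
    moreover have "0 \<le> (\<Sum>l\<in>S. e k l)" using e by (auto simp: delayed_energies_def intro: sum_nonneg)
    then have "0 \<le> B * (\<Sum>l\<in>S. e k l)" using B by simp
    ultimately show ?thesis by (simp add: pair_energy_def B_def algebra_simps)
  qed
  define \<rho> where "\<rho> = root N (1/2)"
  have \<rho>: "0 < \<rho>" "\<rho> < 1" "\<rho> ^ N = 1/2" using N by (auto simp: \<rho>_def)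
  have "(\<rho>\<^sup>2) ^ N = (\<rho> ^ N)\<^sup>2" by (metis power_mult mult.commute)
  then have \<theta>: "(\<rho>\<^sup>2) ^ N = 1/4" "0 < \<rho>\<^sup>2" "\<rho>\<^sup>2 \<le> 1"
    using \<rho> by (auto simp: power2_eq_square mult_le_one)
  define C where "C = sqrt ((B / \<rho>\<^sup>2) ^ N)"
  have "1 \<le> B / \<rho>\<^sup>2" using B \<theta> by simp
  then have C: "C \<ge> 1" "C\<^sup>2 = (B / \<rho>\<^sup>2) ^ N" by (auto simp: C_def one_le_power)
  have "pair_energy S e k \<le> (C * \<rho> ^ k)\<^sup>2 * pair_energy S e 0" if e: "delayed_energies S e" for e k
  proof -
    have block: "pair_energy S e (i + N) \<le> (\<rho>\<^sup>2) ^ N * pair_energy S e i" for i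
      using quarter[OF e, of i] unfolding \<theta>(1) .
    have "pair_energy S e k \<le> (B / \<rho>\<^sup>2) ^ N * (\<rho>\<^sup>2) ^ k * pair_energy S e 0"
      by (rule geometric_decay_of_block_contraction)
        (use N B \<theta>(2,3) grow[OF e] block pair_energy_nonneg[OF e] in auto)
    then show ?thesis by (simp add: C(2) power_mult_distrib power_even_eq[symmetric] flip: power_mult)
        (simp add: mult.commute)
  qed
  then show ?thesis using C(1) \<rho>(1,2) by blast
qed

section \<open>The delayed weighted rule\<close>

lemma spd_spectrum_pos:
  assumes "spd H" "l \<in> spectrum H"
  shows "0 < l"
proof -
  obtain v where "v \<noteq> 0" "H *v v = l *\<^sub>R v"
    using assms(2) by (auto simp: spectrum_def eigenspace_def)
  then have "0 < l * (v \<bullet> v)" using assms(1) by (metis inner_scaleR_right spd_def)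
  moreover have "0 < v \<bullet> v" using \<open>v \<noteq> 0\<close> by simp
  ultimately show ?thesis by (simp add: zero_less_mult_iff)
qed

lemma matrix_inv_apply:
  fixes A :: "real^'n^'n"
  assumes inj: "\<And>x. A *v x = 0 \<Longrightarrow> x = 0"
  shows "A *v (matrix_inv A *v x) = x" and "matrix_inv A *v (A *v x) = x"
proof -
  obtain B where "B ** A = mat 1" using inj matrix_left_invertible_ker[of A] by auto
  then have "\<exists>B. A ** B = mat 1 \<and> B ** A = mat 1" using matrix_left_right_inverse by blast
  then have "A ** matrix_inv A = mat 1 \<and> matrix_inv A ** A = mat 1"
    unfolding matrix_inv_def by (rule someI_ex)
  then show "A *v (matrix_inv A *v x) = x" "matrix_inv A *v (A *v x) = x"
    by (simp_all add: matrix_vector_mul_assoc)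
qed

lemma spd_matrix_inv:
  assumes "spd H"
  shows "H *v (matrix_inv H *v x) = x"
  using assms by (intro matrix_inv_apply) (force simp: spd_def)

lemma eigenvalue_le_onorm:
  fixes A :: "real^'n^'n"
  assumes "A *v v = c *\<^sub>R v" "v \<noteq> 0"
  shows "\<bar>c\<bar> \<le> onorm ((*v) A)"
  using onorm[OF matrix_vector_mul_bounded_linear, of A v] assms by simp

text \<open>
  Eigenvectors of \<open>H\<close> at \<open>l\<close> and \<open>m\<close> are eigenvectors of \<open>W\<close> and of its inverse, with eigenvalues
  \<open>w l\<close> and \<open>1 / w m\<close>, and an operator norm dominates every eigenvalue.
\<close>

lemma weight_ratio_le_cond2:
  fixes H :: "real^'n^'n"
  assumes H: "transpose H = H" and w: "\<And>l. l \<in> spectrum H \<Longrightarrow> w l > 0"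
    and l: "l \<in> spectrum H" and m: "m \<in> spectrum H"
  shows "w l / w m \<le> cond2 (matrix_fun w H)"
proof -
  let ?W = "matrix_fun w H"
  have eig: "?W *v v = w j *\<^sub>R v" if "v \<in> eigenspace H j" "j \<in> spectrum H" for v j
    using that finite_spectrum[OF H]
    by (simp add: matrix_fun_apply eigenproj_eigenvector[OF H] if_distrib[of "scaleR _"] cong: if_cong)
  have "x = 0" if "?W *v x = 0" for x
  proof -
    have "w j *\<^sub>R eigenproj H j x = 0" if "j \<in> spectrum H" for j
      using eigenproj_combination[OF H that, of w x] \<open>?W *v x = 0\<close>
      by (simp add: matrix_fun_apply)
    then have "eigenproj H j x = 0" if "j \<in> spectrum H" for j using w[OF that] that by fastforce
    then show "x = 0" using spectral_resolution[OF H, of x] by simp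
  qed
  note inv = matrix_inv_apply(2)[of ?W, OF this]
  obtain u v where u: "u \<noteq> 0" "u \<in> eigenspace H l" and v: "v \<noteq> 0" "v \<in> eigenspace H m"
    using l m by (auto simp: spectrum_def)
  have "matrix_inv ?W *v (w m *\<^sub>R v) = v" using inv[of v] eig[OF v(2) m] by simp
  then have "w m *\<^sub>R (matrix_inv ?W *v v) = v" by (simp add: matrix_vector_mult_scaleR)
  then have "inverse (w m) *\<^sub>R (w m *\<^sub>R (matrix_inv ?W *v v)) = inverse (w m) *\<^sub>R v" by simp
  then have "matrix_inv ?W *v v = inverse (w m) *\<^sub>R v" using w[OF m] by simp
  from eigenvalue_le_onorm[OF this v(1)] eigenvalue_le_onorm[OF eig[OF u(2) l] u(1)]
  have "w l * inverse (w m) \<le> onorm ((*v) ?W) * onorm ((*v) (matrix_inv ?W))"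
    using w[OF l] w[OF m] by (intro mult_mono) auto
  then show ?thesis by (simp add: cond2_def divide_inverse)
qed

lemma weighted_step_spectral:
  fixes H :: "real^'n^'n"
  assumes H: "transpose H = H"
  shows "weighted_step H (matrix_fun w H) u =
     (\<Sum>l\<in>spectrum H. w l * (norm (eigenproj H l u))\<^sup>2) /
     (\<Sum>l\<in>spectrum H. l * (w l * (norm (eigenproj H l u))\<^sup>2))"
proof -
  have WH: "(matrix_fun w H ** H) *v u = (\<Sum>l\<in>spectrum H. (l * w l) *\<^sub>R eigenproj H l u)"
    unfolding matrix_vector_mul_assoc[symmetric] matrix_fun_apply spectral_decomposition[OF H, of u]
    by (intro sum.cong refl) (subst eigenproj_combination[OF H], auto simp: mult.commute)
  show ?thesis
    unfolding weighted_step_def WH matrix_fun_apply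
    using inner_spectral[OF H, of "\<lambda>_. 1" u w] inner_spectral[OF H, of "\<lambda>_. 1" u "\<lambda>l. l * w l"]
    by (simp add: spectral_resolution[OF H] mult.assoc)
qed

lemma min_eigenvalue_bounds:
  fixes H :: "real^'n^'n"
  assumes "spd H"
  shows "0 < min_eigenvalue H"
    and "min_eigenvalue H * norm v \<le> norm (H *v v)"
    and "min_eigenvalue H * (v \<bullet> (H *v v)) \<le> (norm (H *v v))\<^sup>2"
proof -
  let ?a = "min_eigenvalue H" and ?S = "spectrum H" and ?p = "\<lambda>l. (norm (eigenproj H l v))\<^sup>2"
  have H: "transpose H = H" using assms by (simp add: spd_def)
  note S = finite_spectrum[OF H] spectrum_nonempty[OF H]
  show a: "0 < ?a" using S spd_spectrum_pos[OF assms] by (simp add: min_eigenvalue_def)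
  have al: "?a \<le> l" if "l \<in> ?S" for l using S that by (simp add: min_eigenvalue_def)
  have l0: "0 \<le> l" if "l \<in> ?S" for l using al[OF that] a by linarith
  have Hv: "(norm (H *v v))\<^sup>2 = (\<Sum>l\<in>?S. l * l * ?p l)"
    unfolding power2_norm_eq_inner spectral_decomposition[OF H] inner_spectral[OF H] ..
  have vHv: "v \<bullet> (H *v v) = (\<Sum>l\<in>?S. l * ?p l)"
    using inner_spectral[OF H, of "\<lambda>_. 1" v "\<lambda>l. l"]
    by (simp add: spectral_resolution[OF H] spectral_decomposition[OF H, of v])
  show "?a * (v \<bullet> (H *v v)) \<le> (norm (H *v v))\<^sup>2"
    unfolding Hv vHv sum_distrib_left mult.assoc
    using al l0 by (intro sum_mono mult_right_mono) auto
  have "(?a * norm v)\<^sup>2 \<le> (norm (H *v v))\<^sup>2"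
    unfolding Hv power_mult_distrib parseval[OF H, of v] sum_distrib_left power2_eq_square[of ?a]
    using al a by (intro sum_mono mult_right_mono mult_mono) (auto simp: l0)
  then show "?a * norm v \<le> norm (H *v v)" by (rule power2_le_imp_le) simp
qed

lemma quad_obj_gap:
  assumes "spd H"
  shows "quad_obj H c x - quad_obj H c (quad_argmin H c)
    = 1/2 * ((x - quad_argmin H c) \<bullet> (H *v (x - quad_argmin H c)))"
proof -
  let ?z = "quad_argmin H c"
  have z: "H *v ?z = c" unfolding quad_argmin_def by (rule spd_matrix_inv[OF assms])
  have "x \<bullet> c = ?z \<bullet> (H *v x)"
    using symmetric_inner[of H x ?z] assms by (simp add: z spd_def inner_commute)
  then show ?thesis
    by (simp add: quad_obj_def matrix_vector_mult_diff_distrib inner_simps z inner_commute[of c]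
        algebra_simps)
qed

lemma delayed_rule_gradient_step:
  assumes "delayed_weighted_rule H W c s x" and "g = (\<lambda>k. quad_grad H c (x k))" and "g k \<noteq> 0"
  shows "g (Suc k) = g k - s k *\<^sub>R (H *v g k)"
proof -
  let ?z = "quad_argmin H c"
  have "x (k + 1) = x k - s k *\<^sub>R g k"
    using assms(1,3) unfolding delayed_weighted_rule_def assms(2) by blast
  then have "x (Suc k) - ?z = (x k - ?z) - s k *\<^sub>R g k" by simp
  then have "g (Suc k) = H *v ((x k - ?z) - s k *\<^sub>R g k)"
    unfolding assms(2) quad_grad_def by (rule arg_cong)
  then show ?thesis
    using assms(2) by (simp add: quad_grad_def matrix_vector_mult_diff_distrib matrix_vector_mult_scaleR)
qed

text \<open>
  The link between the iteration and the scalar recursion. Energies are indexed from the gradient \<open>g 1\<close>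
  on, since the bound to be proved is relative to \<open>g 1\<close> and \<open>g 2\<close>. The next gradient \<open>g 3\<close> is already
  determined by these two, whatever \<open>g 0\<close> and the first stepsize were.
\<close>

lemma delayed_rule_energies:
  fixes H :: "real^'n^'n"
  assumes H: "transpose H = H" and w: "\<And>l. l \<in> spectrum H \<Longrightarrow> w l > 0"
    and rule: "delayed_weighted_rule H (matrix_fun w H) c s x"
    and g: "g = (\<lambda>k. quad_grad H c (x k))"
  shows "delayed_energies (spectrum H) (\<lambda>k l. w l * (norm (eigenproj H l (g (Suc k))))\<^sup>2)"
    (is "delayed_energies ?S ?e")
proof -
  have nn: "0 \<le> ?e k l" if "l \<in> ?S" for k l using w[OF that] by simp
  have stop: "g (Suc k) = 0" if "g k = 0" for k
    using rule that unfolding delayed_weighted_rule_def g by (meson le_SucI order_refl)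
  have stay: "?e k l = 0" if "g (Suc k) = 0" for k l
    using that by simp
  have zero: "g (Suc k) = 0" if "(\<Sum>l\<in>?S. ?e k l) = 0" for k
  proof -
    have "\<forall>l\<in>?S. ?e k l = 0"
      using that nn finite_spectrum[OF H] by (subst (asm) sum_nonneg_eq_0_iff) auto
    then have "\<forall>l\<in>?S. eigenproj H l (g (Suc k)) = 0" using w by fastforce
    then show ?thesis using spectral_resolution[OF H, of "g (Suc k)"] by simp
  qed
  have step: "?e (Suc (Suc k)) l = (1 - (\<Sum>m\<in>?S. ?e k m) / (\<Sum>m\<in>?S. m * ?e k m) * l)\<^sup>2 * ?e (Suc k) l"
    if nz: "(\<Sum>l\<in>?S. ?e k l) \<noteq> 0" and l: "l \<in> ?S" for k l
  proof (cases "g (Suc (Suc k)) = 0")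
    case True
    then show ?thesis using stay[OF True, of l] stay[OF stop[OF True], of l] by simp
  next
    case False
    have g1: "g (Suc k) \<noteq> 0" 
    proof
      assume "g (Suc k) = 0"
      then have "(\<Sum>l\<in>?S. ?e k l) = 0" using stay by (intro sum.neutral ballI)
      with nz show False ..
    qed
    let ?t = "(\<Sum>m\<in>?S. ?e k m) / (\<Sum>m\<in>?S. m * ?e k m)"
    have "s (Suc (Suc k)) = weighted_step H (matrix_fun w H) (g (Suc k))"
    proof -
      have "\<forall>k\<ge>1. quad_grad H c (x (k - 1)) \<noteq> 0 \<longrightarrow>
          s k = weighted_step H (matrix_fun w H) (quad_grad H c (x (k - 1)))"
        using rule unfolding delayed_weighted_rule_def by blast
      from this[rule_format, of "Suc (Suc k)"] g1 show ?thesis by (simp add: g)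
    qed
    then have s: "s (Suc (Suc k)) = ?t" by (simp add: weighted_step_spectral[OF H])
    have PH: "eigenproj H l (H *v y) = l *\<^sub>R eigenproj H l y" for y
      unfolding spectral_decomposition[OF H, of y] by (rule eigenproj_combination[OF H l])
    have "eigenproj H l (g (Suc (Suc (Suc k)))) = (1 - ?t * l) *\<^sub>R eigenproj H l (g (Suc (Suc k)))"
      unfolding delayed_rule_gradient_step[OF rule g False] s
      by (simp add: linear_diff[OF linear_eigenproj] linear_cmul[OF linear_eigenproj] PH scaleR_diff_left)
    then show ?thesis by (simp add: power_mult_distrib)
  qed
  have "?e (Suc k) l = 0" if "(\<Sum>l\<in>?S. ?e k l) = 0" for k l
    using stay[OF stop[OF zero[OF that]]] .
  then show ?thesis
    unfolding delayed_energies_def using nn step by presburger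
qed

lemma weighted_energy_bounds:
  fixes H :: "real^'n^'n"
  assumes H: "transpose H = H" and w: "\<And>l. l \<in> spectrum H \<Longrightarrow> p \<le> w l \<and> w l \<le> q"
  shows "p * (norm x)\<^sup>2 \<le> (\<Sum>l\<in>spectrum H. w l * (norm (eigenproj H l x))\<^sup>2)"
    and "(\<Sum>l\<in>spectrum H. w l * (norm (eigenproj H l x))\<^sup>2) \<le> q * (norm x)\<^sup>2"
  unfolding parseval[OF H, of x] sum_distrib_left using w by (auto intro!: sum_mono mult_right_mono)

theorem corollary3p5:
  fixes H :: "real^'n^'n"
  assumes "spd H"
  shows "\<exists>C \<rho>. C \<ge> 1 \<and> 0 < \<rho> \<and> \<rho> < 1 \<and>
    (\<forall>(c :: real^'n) (W :: real^'n^'n) (\<alpha> :: nat \<Rightarrow> real) (x :: nat \<Rightarrow> real^'n) (g :: nat \<Rightarrow> real^'n).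
       positive_spectral_weight H W \<longrightarrow>
       \<alpha> 0 > 0 \<longrightarrow>
       delayed_weighted_rule H W c \<alpha> x \<longrightarrow>
       g = (\<lambda>k. quad_grad H c (x k)) \<longrightarrow>
       (\<forall>k\<ge>1.
          norm (g k, g (k + 1)) \<le> C * sqrt (cond2 W) * \<rho> ^ (k - 1) * norm (g 1, g 2) \<and>
          norm (x k - quad_argmin H c)
            \<le> inverse (min_eigenvalue H) * C * sqrt (cond2 W) * \<rho> ^ (k - 1) * norm (g 1, g 2) \<and>
          0 \<le> quad_obj H c (x k) - quad_obj H c (quad_argmin H c) \<and>
          quad_obj H c (x k) - quad_obj H c (quad_argmin H c)
            \<le> C\<^sup>2 * cond2 W / (2 * min_eigenvalue H) * \<rho> ^ (2 * (k - 1)) * (norm (g 1, g 2))\<^sup>2))"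
proof -
  have H: "transpose H = H" using assms by (simp add: spd_def)
  note S = finite_spectrum[OF H] spectrum_nonempty[OF H]
  note a = min_eigenvalue_bounds[OF assms]
  obtain C \<rho> where C: "C \<ge> 1" and \<rho>: "0 < \<rho>" "\<rho> < 1"
    and decay: "\<And>e k. delayed_energies (spectrum H) e \<Longrightarrow>
        pair_energy (spectrum H) e k \<le> (C * \<rho> ^ k)\<^sup>2 * pair_energy (spectrum H) e 0"
    using delayed_energies_geometric_decay[OF S spd_spectrum_pos[OF assms]] by blast
  show ?thesis
  proof (rule exI[of _ C], rule exI[of _ \<rho>], intro conjI allI impI C \<rho>)
    fix c W \<alpha> x g k
    assume "positive_spectral_weight H W" and rule: "delayed_weighted_rule H W c \<alpha> x"
      and g: "g = (\<lambda>k. quad_grad H c (x k))" and "(1::nat) \<le> k"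
    then obtain w where w: "\<And>l. l \<in> spectrum H \<Longrightarrow> w l > 0" and W: "W = matrix_fun w H"
      by (auto simp: positive_spectral_weight_def)
    obtain j where k: "k = Suc j" using \<open>1 \<le> k\<close> by (cases k) auto
    define e where "e k l = w l * (norm (eigenproj H l (g (Suc k))))\<^sup>2" for k l
    define p where "p = Min (w ` spectrum H)"
    define q where "q = Max (w ` spectrum H)"
    have pq: "\<And>l. l \<in> spectrum H \<Longrightarrow> p \<le> w l \<and> w l \<le> q" and "0 < p"
      using S w by (auto simp: p_def q_def)
    have "p \<in> w ` spectrum H" "q \<in> w ` spectrum H" using S by (simp_all add: p_def q_def)
    then have \<kappa>: "q / p \<le> cond2 W" 
      unfolding W using weight_ratio_le_cond2[of H w, OF H w] by blast
    have "0 < q" using pq \<open>0 < p\<close> S(2) by fastforce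
    then have "0 \<le> cond2 W" using \<kappa> \<open>0 < p\<close> by (meson divide_pos_pos less_imp_le order_trans)
    have N: "(norm (y, z))\<^sup>2 = (norm y)\<^sup>2 + (norm z)\<^sup>2" for y z :: "real^'n"
      by (simp add: norm_Pair)
    \<comment> \<open>The only place where the weight costs anything: energy and squared norm differ by factors in \<open>[p, q]\<close>.\<close>
    have lo: "p * (norm (g (Suc i), g (Suc (Suc i))))\<^sup>2 \<le> pair_energy (spectrum H) e i"
      and hi: "pair_energy (spectrum H) e i \<le> q * (norm (g (Suc i), g (Suc (Suc i))))\<^sup>2" for i
      unfolding N pair_energy_def e_def distrib_left
      by (intro add_mono weighted_energy_bounds[OF H pq]; assumption)+
    have "p * (norm (g k, g (k + 1)))\<^sup>2 \<le> (C * \<rho> ^ j)\<^sup>2 * (q * (norm (g 1, g 2))\<^sup>2)"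
    proof -
      have "delayed_energies (spectrum H) e"
        unfolding e_def using delayed_rule_energies[OF H w rule[unfolded W] g] .
      from decay[OF this, of j] lo[of j] mult_left_mono[OF hi[of 0], of "(C * \<rho> ^ j)\<^sup>2"]
      show ?thesis by (simp add: k numeral_2_eq_2)
    qed
    then have "(norm (g k, g (k + 1)))\<^sup>2 \<le> q / p * ((C * \<rho> ^ j)\<^sup>2 * (norm (g 1, g 2))\<^sup>2)"
      using \<open>0 < p\<close> by (simp add: field_simps)
    also have "\<dots> \<le> cond2 W * ((C * \<rho> ^ j)\<^sup>2 * (norm (g 1, g 2))\<^sup>2)"
      using \<kappa> by (intro mult_right_mono) auto
    finally have sq: "(norm (g k, g (k + 1)))\<^sup>2 \<le> cond2 W * ((C * \<rho> ^ j)\<^sup>2 * (norm (g 1, g 2))\<^sup>2)" .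
    also have "\<dots> = (C * sqrt (cond2 W) * \<rho> ^ j * norm (g 1, g 2))\<^sup>2"
      using \<open>0 \<le> cond2 W\<close> by (simp add: power_mult_distrib)
    finally have main: "norm (g k, g (k + 1)) \<le> C * sqrt (cond2 W) * \<rho> ^ j * norm (g 1, g 2)"
      by (rule power2_le_imp_le) (use C \<rho> \<open>0 \<le> cond2 W\<close> in simp)
    then show "norm (g k, g (k + 1)) \<le> C * sqrt (cond2 W) * \<rho> ^ (k - 1) * norm (g 1, g 2)"
      by (simp add: k)
    have gk: "g k = H *v (x k - quad_argmin H c)" by (simp add: g quad_grad_def)
    have single_sq: "(norm (g k))\<^sup>2 \<le> (norm (g k, g (k + 1)))\<^sup>2" unfolding N by simp
    then have single: "norm (g k) \<le> norm (g k, g (k + 1))" by (rule power2_le_imp_le) simp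
    have "norm (x k - quad_argmin H c) \<le> inverse (min_eigenvalue H) * norm (g k)"
      using a(1) a(2)[of "x k - quad_argmin H c"] by (simp add: gk field_simps)
    also have "\<dots> \<le> inverse (min_eigenvalue H) * (C * sqrt (cond2 W) * \<rho> ^ j * norm (g 1, g 2))"
      using a(1) single main by (intro mult_left_mono) auto
    finally show "norm (x k - quad_argmin H c)
        \<le> inverse (min_eigenvalue H) * C * sqrt (cond2 W) * \<rho> ^ (k - 1) * norm (g 1, g 2)"
      by (simp add: k mult.assoc)
    show "0 \<le> quad_obj H c (x k) - quad_obj H c (quad_argmin H c)"
      unfolding quad_obj_gap[OF assms] using assms
      by (cases "x k = quad_argmin H c") (auto simp: spd_def less_imp_le)
    have "quad_obj H c (x k) - quad_obj H c (quad_argmin H c) \<le> (norm (g k))\<^sup>2 / (2 * min_eigenvalue H)"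
      unfolding quad_obj_gap[OF assms] gk
      using a(1) a(3)[of "x k - quad_argmin H c"] by (simp add: field_simps)
    also have "\<dots> \<le> cond2 W * ((C * \<rho> ^ j)\<^sup>2 * (norm (g 1, g 2))\<^sup>2) / (2 * min_eigenvalue H)"
      using a(1) order_trans[OF single_sq sq] by (intro divide_right_mono) auto
    finally show "quad_obj H c (x k) - quad_obj H c (quad_argmin H c)
        \<le> C\<^sup>2 * cond2 W / (2 * min_eigenvalue H) * \<rho> ^ (2 * (k - 1)) * (norm (g 1, g 2))\<^sup>2"
      by (simp add: k power_mult_distrib power_even_eq[symmetric] ac_simps flip: power_mult)
  qed
qed

end
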